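(* Let $P$ be any one of the polyhedra (1)–(14) listed in the context, and suppose that $P$ is a proven convex hull in the sense that every variable of $P$ other than the power-output variables takes integer values in every extreme point of $P$. The description of $P$ contains exactly one of the following three families of constraints (the maximum commitment (MC) constraints of $P$), each with right-hand side $1$: $$u_t\le 1\quad\forall t\in\mathcal T,\qquad\text{or}\qquad w_t+u_t\le 1\quad\forall t\in\mathcal T^0,\qquad\text{or}\qquad \sum_{i=t-\underline T^{\mathrm{dn}}+1}^{t}w_i+u_t\le 1\quad\forall t\in\mathcal T^{\mathrm{dn}} .$$ Let $P'$ be the polyhedron obtained from $P$ by introducing one new real variable $u^{\mathrm{inv}}$, replacing the right-hand side $1$ of every MC constraint of $P$ by $u^{\mathrm{inv}}$, keeping all other constraints of $P$ unchanged, and adding the constraint $u^{\mathrm{inv}}\le 1$. Then in every extreme point of $P'$ all variables of $P'$ other than the power-output variables (that is, $u^{\mathrm{inv}}$ and all variables $u_t$ and, when present, $v_t,w_t$) are integer.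
   Context: Single-unit unit commitment problem. $\mathcal T=\{t_0,\dots,t_{end}\}$ is a finite set of consecutive time periods, $\mathcal T^0=\mathcal T\setminus\{t_0\}$. Variables: production $p_t$ and commitment status $u_t$ ($t\in\mathcal T$), start-up $v_t$ and shut-down $w_t$ ($t\in\mathcal T^0$); all are real variables in the polyhedra below. The power-output variables are the $p_t$ (and, in (14), also $p^{\mathrm{traj}}_t,p^{\mathrm T}_t$). Parameters: minimum/maximum output $0\le\underline P\le\overline P$; ramp limits $\overline R^{\mathrm{up}},\overline R^{\mathrm{dn}}$; start-up/shut-down capabilities $\overline P^{\mathrm{su}},\overline P^{\mathrm{sd}}$ with $\underline P\le\overline P^{\mathrm{su}}\le\underline P+\overline R^{\mathrm{up}}$, $\underline P\le\overline P^{\mathrm{sd}}\le\underline P+\overline R^{\mathrm{dn}}$; minimum up/down times $\underline T^{\mathrm{up}},\underline T^{\mathrm{dn}}\ge1$; $\mathcal T^{\mathrm{up}}=\{t\in\mathcal T:t\ge t_0+\underline T^{\mathrm{up}}\}$, $\mathcal T^{\mathrm{dn}}=\{t\in\mathcal T:t\ge t_0+\underline T^{\mathrm{dn}}\}$. Write $[a]^+=\max\{a,0\}$. Constraint families: - (U) $p_t\le\overline P u_t$, $t\in\mathcal T$. (L) $p_t\ge\underline P u_t$, $t\in\mathcal T$. - (RU) $p_t-p_{t-1}\le(\underline P+\overline R^{\mathrm{up}})u_t-\underline P u_{t-1}$, $t\in\mathcal T^0$. (RD) $p_{t-1}-p_t\le(\underline P+\overline R^{\mathrm{dn}})u_{t-1}-\underline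 P u_t$, $t\in\mathcal T^0$. - (BU) $p_t\le(\underline P+\overline R^{\mathrm{up}})u_t+(\overline P-\underline P-\overline R^{\mathrm{up}})u_{t-1}$, $t\in\mathcal T^0$. (BD) $p_{t-1}\le(\underline P+\overline R^{\mathrm{dn}})u_{t-1}+(\overline P-\underline P-\overline R^{\mathrm{dn}})u_t$, $t\in\mathcal T^0$. - (SU1) $p_t-p_{t-1}\le\overline P^{\mathrm{su}}u_t-(\overline P^{\mathrm{su}}-\overline R^{\mathrm{up}})u_{t-1}$, $t\in\mathcal T^0$. (SD1) $p_{t-1}-p_t\le\overline P^{\mathrm{sd}}u_{t-1}-(\overline P^{\mathrm{sd}}-\overline R^{\mathrm{dn}})u_t$, $t\in\mathcal T^0$. - (SU2) $p_t\le\overline P^{\mathrm{su}}u_t+(\overline P-\overline P^{\mathrm{su}})u_{t-1}$, $t\in\mathcal T^0$. (SD2) $p_{t-1}\le\overline P^{\mathrm{sd}}u_{t-1}+(\overline P-\overline P^{\mathrm{sd}})u_t$, $t\in\mathcal T^0$. - (C) $u_t-u_{t-1}=v_t-w_t$, $t\in\mathcal T^0$. (V) $v_t\le u_t$, $t\in\mathcal T^0$. (W) $w_t+u_t\le1$, $t\in\mathcal T^0$. (N) $v_t\ge0$, $w_t\ge0$, $t\in\mathcal T^0$. (M) $u_t\le1$, $t\in\mathcal T$. - (VL) $v_t\ge u_t-u_{t-1}$ and $w_t\ge u_{t-1}-u_t$, $t\in\mathcal T^0$. - (MU) $\sum_{i=t-\underline T^{\mathrm{up}}+1}^{t}v_i\le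 u_t$, $t\in\mathcal T^{\mathrm{up}}$. (MD) $\sum_{i=t-\underline T^{\mathrm{dn}}+1}^{t}w_i+u_t\le1$, $t\in\mathcal T^{\mathrm{dn}}$. - (SU3) $p_t-p_{t-1}\le(\overline P^{\mathrm{su}}-\underline P-\overline R^{\mathrm{up}})v_t+(\underline P+\overline R^{\mathrm{up}})u_t-\underline P u_{t-1}$, $t\in\mathcal T^0$. (SD3) $p_{t-1}-p_t\le(\overline P^{\mathrm{sd}}-\underline P-\overline R^{\mathrm{dn}})w_t+(\underline P+\overline R^{\mathrm{dn}})u_{t-1}-\underline P u_t$, $t\in\mathcal T^0$. - (SU4) $p_t\le\overline P u_t-(\overline P-\overline P^{\mathrm{su}})v_t$, $t\in\mathcal T^0$. (SD4) $p_{t-1}\le\overline P u_{t-1}-(\overline P-\overline P^{\mathrm{sd}})w_t$, $t\in\mathcal T^0$. - (K) for $t\in\mathcal T\setminus\{t_0,t_{end}\}$: if $\underline T^{\mathrm{up}}\ge2$, $p_t\le\overline P u_t-(\overline P-\overline P^{\mathrm{su}})v_t-(\overline P-\overline P^{\mathrm{sd}})w_{t+1}$; if $\underline T^{\mathrm{up}}=1$, both $p_t\le\overline P u_t-(\overline P-\overline P^{\mathrm{su}})v_t-[\overline P^{\mathrm{su}}-\overline P^{\mathrm{sd}}]^+w_{t+1}$ and $p_t\le\overline P u_t-[\overline P^{\mathrm{sd}}-\overline P^{\mathrm{su}}]^+v_t-(\overline P-\overline P^{\mathrm{sd}})w_{t+1}$. - (T) $p^{\mathrm{traj}}_t=\sum_{i=1}^{T^{\mathrm{su}}}P^{\mathrm{su}}_i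 v_{T^{\mathrm{su}}+t+1-i}+\sum_{i=1}^{T^{\mathrm{sd}}}P^{\mathrm{sd}}_i w_{t-i+1}$ and $p^{\mathrm T}_t=p_t+p^{\mathrm{traj}}_t$, $t\in\mathcal T$, where $T^{\mathrm{su}},T^{\mathrm{sd}}$ are the durations and $P^{\mathrm{su}}_i,P^{\mathrm{sd}}_i$ the outputs of the start-up and shut-down trajectories, and terms with indices outside $\mathcal T^0$ are omitted. The polyhedra (each defined by the listed families; in those marked "$|\mathcal T|=2$" the horizon is two periods, and otherwise $\mathcal T$ is arbitrary): Polyhedra in the variables $p,u$: (1) U, L, M; (2) U, L, RU, BU, M ($|\mathcal T|=2$); (3) U, L, RD, BD, M ($|\mathcal T|=2$); (4) U, L, RU, RD, BU, BD, M ($|\mathcal T|=2$); (5) U, L, RU, SU1, SU2, M ($|\mathcal T|=2$), or U, L, RD, SD1, SD2, M ($|\mathcal T|=2$); (6) U, L, RU, RD, SU1, SD1, SU2, SD2, M ($|\mathcal T|=2$). Polyhedra in the variables $p,u,v,w$ (in $u,v,w$ only, when no constraint involves $p$): (7) C, V, W, N; (8) U, L, C, V, W, N; (9) U, L, C, M, N, or U, L, VL, M, N; (10) C, MU, MD, N, or U, L, C, MU, MD, N; (11) L, C, MU, MD, K, N; (12) L, C, V, W, SU3, SU4, N ($|\mathcal T|=2$), or L, C, V, W, SD3, SD4, N ($|\mathcal T|=2$); (13) L, C, V, W, SU3, SD3, SU4, SD4, N ($|\mathcal T|=2$); (14) L, C, V, W, SU3, SD3, SU4, SD4, N, T ($|\mathcal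 T|=2$), with additional variables $p^{\mathrm{traj}}_t,p^{\mathrm T}_t$. *)

theory Defs
  imports "HOL-Analysis.Analysis" "HOL-Analysis.Finite_Function_Topology"
begin

text \<open>
  Single-unit unit commitment. Time is \<^typ>\<open>int\<close>, so that the lower
  summation bounds below are not subject to truncated subtraction.
\<close>

record uc_data =
  t_first :: int
  t_last :: int
  P_min :: real
  P_max :: real
  R_up :: real
  R_dn :: real
  P_su :: real
  P_sd :: real
  T_up :: nat
  T_dn :: nat
  T_su :: nat
  T_sd :: nat
  traj_su :: "nat \<Rightarrow> real"
  traj_sd :: "nat \<Rightarrow> real"

definition valid_data :: "uc_data \<Rightarrow> bool" where
  "valid_data d \<longleftrightarrow>
     t_first d \<le> t_last d \<and>
     0 \<le> P_min d \<and> P_min d \<le> P_max d \<and>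
     P_min d \<le> P_su d \<and> P_su d \<le> P_min d + R_up d \<and>
     P_min d \<le> P_sd d \<and> P_sd d \<le> P_min d + R_dn d \<and>
     1 \<le> T_up d \<and> 1 \<le> T_dn d"

definition periods :: "uc_data \<Rightarrow> int set" where
  "periods d = {t_first d..t_last d}"

definition periods0 :: "uc_data \<Rightarrow> int set" where
  "periods0 d = periods d - {t_first d}"

definition periods_up :: "uc_data \<Rightarrow> int set" where
  "periods_up d = {t \<in> periods d. t \<ge> t_first d + int (T_up d)}"

definition periods_dn :: "uc_data \<Rightarrow> int set" where
  "periods_dn d = {t \<in> periods d. t \<ge> t_first d + int (T_dn d)}"

definition pos_part :: "real \<Rightarrow> real" where
  "pos_part a = max a 0"

datatype family =
    Fam_U | Fam_L | Fam_RU | Fam_RD | Fam_BU | Fam_BD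
  | Fam_SU1 | Fam_SD1 | Fam_SU2 | Fam_SD2
  | Fam_C | Fam_V | Fam_W | Fam_N | Fam_M | Fam_VL | Fam_MU | Fam_MD
  | Fam_SU3 | Fam_SD3 | Fam_SU4 | Fam_SD4 | Fam_K | Fam_T

definition mc_families :: "family set" where
  "mc_families = {Fam_M, Fam_W, Fam_MD}"

text \<open>
  The argument \<open>r\<close> is the right-hand side of the maximum commitment constraints
  (\<^const>\<open>Fam_M\<close>, \<^const>\<open>Fam_W\<close>, \<^const>\<open>Fam_MD\<close>): it is the constant 1 in the
  original polyhedra and the value of the new variable in the modified ones.
  No other family depends on it.
\<close>

fun family_holds ::
  "uc_data \<Rightarrow> real \<Rightarrow> (int \<Rightarrow> real) \<Rightarrow> (int \<Rightarrow> real) \<Rightarrow> (int \<Rightarrow> real) \<Rightarrow> (int \<Rightarrow> real) \<Rightarrow>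
   (int \<Rightarrow> real) \<Rightarrow> (int \<Rightarrow> real) \<Rightarrow> family \<Rightarrow> bool" where
  "family_holds d r p u v w ptraj pT Fam_U \<longleftrightarrow>
     (\<forall>t\<in>periods d. p t \<le> P_max d * u t)"
| "family_holds d r p u v w ptraj pT Fam_L \<longleftrightarrow>
     (\<forall>t\<in>periods d. p t \<ge> P_min d * u t)"
| "family_holds d r p u v w ptraj pT Fam_RU \<longleftrightarrow>
     (\<forall>t\<in>periods0 d. p t - p (t - 1) \<le> (P_min d + R_up d) * u t - P_min d * u (t - 1))"
| "family_holds d r p u v w ptraj pT Fam_RD \<longleftrightarrow>
     (\<forall>t\<in>periods0 d. p (t - 1) - p t \<le> (P_min d + R_dn d) * u (t - 1) - P_min d * u t)"
| "family_holds d r p u v w ptraj pT Fam_BU \<longleftrightarrow>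
     (\<forall>t\<in>periods0 d. p t \<le> (P_min d + R_up d) * u t + (P_max d - P_min d - R_up d) * u (t - 1))"
| "family_holds d r p u v w ptraj pT Fam_BD \<longleftrightarrow>
     (\<forall>t\<in>periods0 d. p (t - 1) \<le> (P_min d + R_dn d) * u (t - 1) + (P_max d - P_min d - R_dn d) * u t)"
| "family_holds d r p u v w ptraj pT Fam_SU1 \<longleftrightarrow>
     (\<forall>t\<in>periods0 d. p t - p (t - 1) \<le> P_su d * u t - (P_su d - R_up d) * u (t - 1))"
| "family_holds d r p u v w ptraj pT Fam_SD1 \<longleftrightarrow>
     (\<forall>t\<in>periods0 d. p (t - 1) - p t \<le> P_sd d * u (t - 1) - (P_sd d - R_dn d) * u t)"
| "family_holds d r p u v w ptraj pT Fam_SU2 \<longleftrightarrow>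
     (\<forall>t\<in>periods0 d. p t \<le> P_su d * u t + (P_max d - P_su d) * u (t - 1))"
| "family_holds d r p u v w ptraj pT Fam_SD2 \<longleftrightarrow>
     (\<forall>t\<in>periods0 d. p (t - 1) \<le> P_sd d * u (t - 1) + (P_max d - P_sd d) * u t)"
| "family_holds d r p u v w ptraj pT Fam_C \<longleftrightarrow>
     (\<forall>t\<in>periods0 d. u t - u (t - 1) = v t - w t)"
| "family_holds d r p u v w ptraj pT Fam_V \<longleftrightarrow>
     (\<forall>t\<in>periods0 d. v t \<le> u t)"
| "family_holds d r p u v w ptraj pT Fam_W \<longleftrightarrow>
     (\<forall>t\<in>periods0 d. w t + u t \<le> r)"
| "family_holds d r p u v w ptraj pT Fam_N \<longleftrightarrow>
     (\<forall>t\<in>periods0 d. v t \<ge> 0 \<and> w t \<ge> 0)"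
| "family_holds d r p u v w ptraj pT Fam_M \<longleftrightarrow>
     (\<forall>t\<in>periods d. u t \<le> r)"
| "family_holds d r p u v w ptraj pT Fam_VL \<longleftrightarrow>
     (\<forall>t\<in>periods0 d. v t \<ge> u t - u (t - 1) \<and> w t \<ge> u (t - 1) - u t)"
| "family_holds d r p u v w ptraj pT Fam_MU \<longleftrightarrow>
     (\<forall>t\<in>periods_up d. (\<Sum>i\<in>{t - int (T_up d) + 1..t}. v i) \<le> u t)"
| "family_holds d r p u v w ptraj pT Fam_MD \<longleftrightarrow>
     (\<forall>t\<in>periods_dn d. (\<Sum>i\<in>{t - int (T_dn d) + 1..t}. w i) + u t \<le> r)"
| "family_holds d r p u v w ptraj pT Fam_SU3 \<longleftrightarrow>
     (\<forall>t\<in>periods0 d. p t - p (t - 1)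
        \<le> (P_su d - P_min d - R_up d) * v t + (P_min d + R_up d) * u t - P_min d * u (t - 1))"
| "family_holds d r p u v w ptraj pT Fam_SD3 \<longleftrightarrow>
     (\<forall>t\<in>periods0 d. p (t - 1) - p t
        \<le> (P_sd d - P_min d - R_dn d) * w t + (P_min d + R_dn d) * u (t - 1) - P_min d * u t)"
| "family_holds d r p u v w ptraj pT Fam_SU4 \<longleftrightarrow>
     (\<forall>t\<in>periods0 d. p t \<le> P_max d * u t - (P_max d - P_su d) * v t)"
| "family_holds d r p u v w ptraj pT Fam_SD4 \<longleftrightarrow>
     (\<forall>t\<in>periods0 d. p (t - 1) \<le> P_max d * u (t - 1) - (P_max d - P_sd d) * w t)"
| "family_holds d r p u v w ptraj pT Fam_K \<longleftrightarrow>
     (\<forall>t\<in>periods d - {t_first d, t_last d}.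
        (T_up d \<ge> 2 \<longrightarrow>
           p t \<le> P_max d * u t - (P_max d - P_su d) * v t - (P_max d - P_sd d) * w (t + 1)) \<and>
        (T_up d = 1 \<longrightarrow>
           p t \<le> P_max d * u t - (P_max d - P_su d) * v t - pos_part (P_su d - P_sd d) * w (t + 1) \<and>
           p t \<le> P_max d * u t - pos_part (P_sd d - P_su d) * v t - (P_max d - P_sd d) * w (t + 1)))"
| "family_holds d r p u v w ptraj pT Fam_T \<longleftrightarrow>
     (\<forall>t\<in>periods d.
        ptraj t =
          (\<Sum>i | i \<in> {1..T_su d} \<and> int (T_su d) + t + 1 - int i \<in> periods0 d.
             traj_su d i * v (int (T_su d) + t + 1 - int i)) +
          (\<Sum>i | i \<in> {1..T_sd d} \<and> t - int i + 1 \<in> periods0 d.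
             traj_sd d i * w (t - int i + 1)) \<and>
        pT t = p t + ptraj t)"

datatype formulation =
    Poly_1 | Poly_2 | Poly_3 | Poly_4
  | Poly_5_up | Poly_5_dn
  | Poly_6 | Poly_7 | Poly_8
  | Poly_9_C | Poly_9_VL
  | Poly_10_uvw | Poly_10_puvw
  | Poly_11
  | Poly_12_up | Poly_12_dn
  | Poly_13 | Poly_14

fun families :: "formulation \<Rightarrow> family set" where
  "families Poly_1 = {Fam_U, Fam_L, Fam_M}"
| "families Poly_2 = {Fam_U, Fam_L, Fam_RU, Fam_BU, Fam_M}"
| "families Poly_3 = {Fam_U, Fam_L, Fam_RD, Fam_BD, Fam_M}"
| "families Poly_4 = {Fam_U, Fam_L, Fam_RU, Fam_RD, Fam_BU, Fam_BD, Fam_M}"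
| "families Poly_5_up = {Fam_U, Fam_L, Fam_RU, Fam_SU1, Fam_SU2, Fam_M}"
| "families Poly_5_dn = {Fam_U, Fam_L, Fam_RD, Fam_SD1, Fam_SD2, Fam_M}"
| "families Poly_6 =
     {Fam_U, Fam_L, Fam_RU, Fam_RD, Fam_SU1, Fam_SD1, Fam_SU2, Fam_SD2, Fam_M}"
| "families Poly_7 = {Fam_C, Fam_V, Fam_W, Fam_N}"
| "families Poly_8 = {Fam_U, Fam_L, Fam_C, Fam_V, Fam_W, Fam_N}"
| "families Poly_9_C = {Fam_U, Fam_L, Fam_C, Fam_M, Fam_N}"
| "families Poly_9_VL = {Fam_U, Fam_L, Fam_VL, Fam_M, Fam_N}"
| "families Poly_10_uvw = {Fam_C, Fam_MU, Fam_MD, Fam_N}"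
| "families Poly_10_puvw = {Fam_U, Fam_L, Fam_C, Fam_MU, Fam_MD, Fam_N}"
| "families Poly_11 = {Fam_L, Fam_C, Fam_MU, Fam_MD, Fam_K, Fam_N}"
| "families Poly_12_up = {Fam_L, Fam_C, Fam_V, Fam_W, Fam_SU3, Fam_SU4, Fam_N}"
| "families Poly_12_dn = {Fam_L, Fam_C, Fam_V, Fam_W, Fam_SD3, Fam_SD4, Fam_N}"
| "families Poly_13 =
     {Fam_L, Fam_C, Fam_V, Fam_W, Fam_SU3, Fam_SD3, Fam_SU4, Fam_SD4, Fam_N}"
| "families Poly_14 =
     {Fam_L, Fam_C, Fam_V, Fam_W, Fam_SU3, Fam_SD3, Fam_SU4, Fam_SD4, Fam_N, Fam_T}"

definition two_period :: "formulation \<Rightarrow> bool" where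
  "two_period k \<longleftrightarrow>
     k \<in> {Poly_2, Poly_3, Poly_4, Poly_5_up, Poly_5_dn, Poly_6,
          Poly_12_up, Poly_12_dn, Poly_13, Poly_14}"

datatype var =
  Var_p int | Var_u int | Var_v int | Var_w int | Var_ptraj int | Var_pT int | Var_uinv

definition power_vars :: "var set" where
  "power_vars = range Var_p \<union> range Var_ptraj \<union> range Var_pT"

definition vars :: "uc_data \<Rightarrow> formulation \<Rightarrow> var set" where
  "vars d k =
     (if k \<in> {Poly_7, Poly_10_uvw} then {} else Var_p ` periods d) \<union>
     Var_u ` periods d \<union>
     (if k \<in> {Poly_1, Poly_2, Poly_3, Poly_4, Poly_5_up, Poly_5_dn, Poly_6} then {}
      else Var_v ` periods0 d \<union> Var_w ` periods0 d) \<union>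
     (if k = Poly_14 then Var_ptraj ` periods d \<union> Var_pT ` periods d else {})"

text \<open>
  A point with coordinates indexed by a finite set \<open>X\<close> of variables is a finitely supported
  function on \<^typ>\<open>var\<close> whose support lies in \<open>X\<close>. These points form a copy of the space of
  real vectors indexed by \<open>X\<close>, embedded as a subspace in a real vector space that does not
  depend on the horizon, so that the library notion of extreme point applies directly.
\<close>

type_synonym point = "(var, real) poly_mapping"

definition sat :: "uc_data \<Rightarrow> real \<Rightarrow> point \<Rightarrow> family \<Rightarrow> bool" where
  "sat d r x F \<longleftrightarrow>
     family_holds d r
       (\<lambda>t. Poly_Mapping.lookup x (Var_p t)) (\<lambda>t. Poly_Mapping.lookup x (Var_u t))
       (\<lambda>t. Poly_Mapping.lookup x (Var_v t)) (\<lambda>t. Poly_Mapping.lookup x (Var_w t))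
       (\<lambda>t. Poly_Mapping.lookup x (Var_ptraj t)) (\<lambda>t. Poly_Mapping.lookup x (Var_pT t)) F"

definition uc_poly :: "uc_data \<Rightarrow> formulation \<Rightarrow> point set" where
  "uc_poly d k =
     {x. Poly_Mapping.keys x \<subseteq> vars d k \<and> (\<forall>F\<in>families k. sat d 1 x F)}"

definition uc_poly_inv :: "uc_data \<Rightarrow> formulation \<Rightarrow> point set" where
  "uc_poly_inv d k =
     {x. Poly_Mapping.keys x \<subseteq> insert Var_uinv (vars d k) \<and>
         (\<forall>F\<in>families k. sat d (Poly_Mapping.lookup x Var_uinv) x F) \<and>
         Poly_Mapping.lookup x Var_uinv \<le> 1}"

end

theory Submission
  imports Defs
begin

text \<open>
  Every constraint of the listed polyhedra is linear and, apart from the maximum commitment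
  constraints, homogeneous. Once the right-hand side \<open>1\<close> is replaced by the variable
  \<open>u\<^sup>i\<^sup>n\<^sup>v\<close>, all constraints become homogeneous, so \<open>P'\<close> is the part of a convex cone that
  lies in the halfspace \<open>u\<^sup>i\<^sup>n\<^sup>v \<le> 1\<close> (lemma \<open>sat_scaleR\<close>). An extreme point of \<open>P'\<close> is of one of
  two kinds. If \<open>u\<^sup>i\<^sup>n\<^sup>v < 1\<close>, then it can be stretched and shrunk slightly along its ray within \<open>P'\<close>,
  so it must be the origin (lemma \<open>extreme_point_inv_below_one\<close>). If \<open>u\<^sup>i\<^sup>n\<^sup>v = 1\<close>, then it
  lies in the slice \<open>u\<^sup>i\<^sup>n\<^sup>v = 1\<close> of \<open>P'\<close>, which is a translate of \<open>P\<close>, and so it is the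
  translate of an extreme point of \<open>P\<close> (lemma \<open>extreme_point_inv_at_one\<close>), which
  is integral by hypothesis. Neither case depends on the individual polyhedron.
\<close>

text \<open>
  Homogeneity is jointly in the variables and in the maximum commitment right-hand side \<open>r\<close>. The
  factor must be nonnegative because it multiplies inequalities.
\<close>

lemma family_holds_scale:
  assumes c: "0 \<le> c" and h: "family_holds d r p u v w ptraj pT F"
  shows "family_holds d (c * r) (\<lambda>t. c * p t) (\<lambda>t. c * u t) (\<lambda>t. c * v t) (\<lambda>t. c * w t)
    (\<lambda>t. c * ptraj t) (\<lambda>t. c * pT t) F"
proof -
  have mono: "c * a \<le> c * b" if "a \<le> b" for a b :: real
    using that c by (rule mult_left_mono)
  show ?thesis
  proof (cases F)
    case Fam_C
    then show ?thesis
      using h by (auto simp: right_diff_distrib[symmetric])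
  next
    case Fam_MU
    then show ?thesis
      using h by (auto simp: sum_distrib_left[symmetric] intro: mono)
  next
    case Fam_MD
    then show ?thesis
      using h by (auto simp: sum_distrib_left[symmetric] distrib_left[symmetric] intro: mono)
  next
    case Fam_T
    have pull: "(\<Sum>i\<in>A. a i * (c * b i)) = c * (\<Sum>i\<in>A. a i * b i)"
      for A :: "nat set" and a b :: "nat \<Rightarrow> real"
      by (simp add: sum_distrib_left mult.left_commute)
    from Fam_T show ?thesis
      using h by (auto simp: pull distrib_left)
  next
    case Fam_K
    have scaled: "c * x \<le> a * (c * y) - b * (c * z) - e * (c * s)"
      if "x \<le> a * y - b * z - e * s" for x a y b z e s :: real
      using mono[OF that] by (simp add: algebra_simps)
    from Fam_K show ?thesis
      using h by (auto intro: scaled)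
  qed (use h in \<open>auto dest!: bspec dest: mono simp: algebra_simps\<close>)
qed

lemma lookup_scaleR:
  fixes x :: "('a, 'b::real_vector) poly_mapping"
  shows "Poly_Mapping.lookup (c *\<^sub>R x) z = c *\<^sub>R Poly_Mapping.lookup x z"
proof -
  have "finite {i. c *\<^sub>R Poly_Mapping.lookup x i \<noteq> 0}"
    by (rule finite_subset[OF _ finite_lookup[of x]]) auto
  then show ?thesis
    by (simp add: scaleR_poly_mapping_def Abs_poly_mapping_inverse)
qed

lemma sat_scaleR:
  assumes "0 \<le> c" and "sat d r x F"
  shows "sat d (c * r) (c *\<^sub>R x) F"
  using family_holds_scale[OF assms(1)] assms(2) by (simp add: sat_def lookup_scaleR)

lemma uc_poly_inv_scaleR:
  assumes "x \<in> uc_poly_inv d k" and "0 \<le> c"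
    and "c * Poly_Mapping.lookup x Var_uinv \<le> 1"
  shows "c *\<^sub>R x \<in> uc_poly_inv d k"
proof -
  have "Poly_Mapping.keys (c *\<^sub>R x) \<subseteq> Poly_Mapping.keys x"
    by (auto simp: in_keys_iff lookup_scaleR)
  then show ?thesis
    using assms by (auto simp: uc_poly_inv_def lookup_scaleR intro: sat_scaleR)
qed

text \<open>
  With slack in \<open>u\<^sup>i\<^sup>n\<^sup>v \<le> 1\<close> only cone constraints can be tight, so a nonzero \<open>x\<close> is the midpoint
  of \<open>(1 - e) x\<close> and \<open>(1 + e) x\<close>, which both remain in \<open>P'\<close> for small \<open>e\<close>.
\<close>

lemma extreme_point_inv_below_one:
  assumes ext: "x extreme_point_of uc_poly_inv d k"
    and less: "Poly_Mapping.lookup x Var_uinv < 1"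
  shows "x = 0"
proof (rule ccontr)
  assume nz: "x \<noteq> 0"
  define r where "r = Poly_Mapping.lookup x Var_uinv"
  \<comment> \<open>The bound by \<open>1\<close> keeps the factor \<open>1 - e\<close> nonnegative and covers the case \<open>r < 0\<close>; the bound
    by \<open>1 - r\<close> keeps \<open>(1 + e) * r\<close> at most \<open>1\<close> in the case \<open>0 \<le> r\<close>, where \<open>e * r \<le> e\<close>.\<close>
  define e where "e = min 1 (1 - r)"
  have r: "r < 1"
    using less by (simp add: r_def)
  have e: "0 < e" "e \<le> 1" "e \<le> 1 - r"
    using r by (auto simp: e_def min_def)
  have "(1 + e) * r \<le> 1 \<and> (1 - e) * r \<le> 1"
  proof (cases "0 \<le> r")
    case True
    have "e * r \<le> e"
      using r e(1) by simp
    moreover have "0 \<le> e * r"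
      using True e(1) by simp
    ultimately show ?thesis
      using r e(3) by (auto simp: distrib_right left_diff_distrib)
  next
    case False
    then have "(1 + e) * r \<le> 0" "(1 - e) * r \<le> 0"
      using e by (auto intro!: mult_nonneg_nonpos)
    then show ?thesis
      by auto
  qed
  then have hi1: "(1 + e) * r \<le> 1" and lo1: "(1 - e) * r \<le> 1"
    by simp_all
  have mem: "x \<in> uc_poly_inv d k"
    using ext by (simp add: extreme_point_of_def)
  have lo: "(1 - e) *\<^sub>R x \<in> uc_poly_inv d k"
    using e(2) lo1[unfolded r_def] by (intro uc_poly_inv_scaleR[OF mem]) simp_all
  have hi: "(1 + e) *\<^sub>R x \<in> uc_poly_inv d k"
    using e(1) hi1[unfolded r_def] by (intro uc_poly_inv_scaleR[OF mem]) simp_all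
  have "(1 - e) *\<^sub>R x \<noteq> (1 + e) *\<^sub>R x"
    using nz e by simp
  moreover have "x = (1 - 1/2) *\<^sub>R ((1 - e) *\<^sub>R x) + (1/2) *\<^sub>R ((1 + e) *\<^sub>R x)"
    by (simp flip: scaleR_add_left add_divide_distrib)
  ultimately have "x \<in> open_segment ((1 - e) *\<^sub>R x) ((1 + e) *\<^sub>R x)"
    unfolding in_segment by (intro conjI exI[of _ "1/2"]) auto
  then show False
    using ext lo hi by (auto simp: extreme_point_of_def)
qed

abbreviation uinv_unit :: point where
  "uinv_unit \<equiv> Poly_Mapping.single Var_uinv 1"

lemma uinv_notin_vars: "Var_uinv \<notin> vars d k"
  by (auto simp: vars_def)

lemma lookup_add_uinv:
  "Poly_Mapping.lookup (y + uinv_unit) z =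
     Poly_Mapping.lookup y z + (if z = Var_uinv then 1 else 0)"
  by (auto simp: lookup_add lookup_single when_def)

text \<open>
  The constraint families never read the coordinate \<^const>\<open>Var_uinv\<close> of a point, so the
  translation by its unit vector carries \<open>P\<close> onto the slice \<open>u\<^sup>i\<^sup>n\<^sup>v = 1\<close> of \<open>P'\<close>. The coordinate
  has to be \<open>0\<close> in a point of \<open>P\<close> because \<^const>\<open>Var_uinv\<close> lies outside the allowed support.
\<close>

lemma uc_poly_iff_slice:
  "y \<in> uc_poly d k \<longleftrightarrow>
     y + uinv_unit \<in> uc_poly_inv d k \<and> Poly_Mapping.lookup y Var_uinv = 0"
proof -
  have sat: "sat d r (y + uinv_unit) F \<longleftrightarrow> sat d r y F" for r F
    by (simp add: sat_def lookup_add_uinv)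
  have keys: "Poly_Mapping.keys y \<subseteq> vars d k \<longleftrightarrow>
      Poly_Mapping.keys (y + uinv_unit) \<subseteq> insert Var_uinv (vars d k) \<and>
      Poly_Mapping.lookup y Var_uinv = 0"
    using uinv_notin_vars[of d k]
    by (auto simp: subset_iff in_keys_iff lookup_add_uinv split: if_splits) metis
  show ?thesis
    unfolding uc_poly_def uc_poly_inv_def mem_Collect_eq sat keys lookup_add_uinv by auto
qed

text \<open>
  A segment in \<open>P\<close> around the translated point would move back to a segment in \<open>P'\<close> around \<open>x\<close>.
\<close>

lemma extreme_point_inv_at_one:
  assumes ext: "x extreme_point_of uc_poly_inv d k"
    and one: "Poly_Mapping.lookup x Var_uinv = 1"
  shows "(x - uinv_unit) extreme_point_of uc_poly d k"
  unfolding extreme_point_of_def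
proof (intro conjI ballI notI)
  show "x - uinv_unit \<in> uc_poly d k"
    using ext one by (simp add: uc_poly_iff_slice extreme_point_of_def lookup_minus)
next
  fix a b
  assume "a \<in> uc_poly d k" "b \<in> uc_poly d k"
  then have ab: "a + uinv_unit \<in> uc_poly_inv d k" "b + uinv_unit \<in> uc_poly_inv d k"
    by (simp_all add: uc_poly_iff_slice)
  assume "x - uinv_unit \<in> open_segment a b"
  then obtain s where "a \<noteq> b" "0 < s" "s < 1" and
    s: "x - uinv_unit = (1 - s) *\<^sub>R a + s *\<^sub>R b"
    by (auto simp: in_segment)
  have "x = (1 - s) *\<^sub>R (a + uinv_unit) + s *\<^sub>R (b + uinv_unit)"
    using s by (simp add: algebra_simps)
  then have "x \<in> open_segment (a + uinv_unit) (b + uinv_unit)"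
    unfolding in_segment using \<open>a \<noteq> b\<close> \<open>0 < s\<close> \<open>s < 1\<close> by auto
  then show False
    using ext ab by (auto simp: extreme_point_of_def)
qed

lemma ex1_mc_family: "\<exists>!F. F \<in> families k \<and> F \<in> mc_families"
  by (cases k) (auto simp: mc_families_def)

theorem mainTheorem5:
  fixes d :: uc_data and k :: formulation
  assumes "valid_data d"
    and "two_period k \<Longrightarrow> card (periods d) = 2"
    and proven_convex_hull:
      "\<And>x z. x extreme_point_of (uc_poly d k) \<Longrightarrow> z \<in> vars d k - power_vars
         \<Longrightarrow> Poly_Mapping.lookup x z \<in> \<int>"
  shows "(\<exists>!F. F \<in> families k \<and> F \<in> mc_families) \<and>
    (\<forall>x z. x extreme_point_of (uc_poly_inv d k) \<longrightarrow>
       z \<in> insert Var_uinv (vars d k) - power_vars \<longrightarrow> Poly_Mapping.lookup x z \<in> \<int>)"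
proof (intro conjI allI impI)
  show "\<exists>!F. F \<in> families k \<and> F \<in> mc_families"
    by (rule ex1_mc_family)
next
  fix x z
  assume ext: "x extreme_point_of uc_poly_inv d k"
    and z: "z \<in> insert Var_uinv (vars d k) - power_vars"
  have "Poly_Mapping.lookup x Var_uinv \<le> 1"
    using ext by (simp add: extreme_point_of_def uc_poly_inv_def)
  then consider "Poly_Mapping.lookup x Var_uinv < 1" | "Poly_Mapping.lookup x Var_uinv = 1"
    by linarith
  then show "Poly_Mapping.lookup x z \<in> \<int>"
  proof cases
    case 1
    then show ?thesis
      using extreme_point_inv_below_one[OF ext] by simp
  next
    case 2
    show ?thesis
    proof (cases "z = Var_uinv")
      case True
      then show ?thesis
        using 2 by simp
    next
      case False
      then have "Poly_Mapping.lookup (x - uinv_unit) z \<in> \<int>"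
        using proven_convex_hull[OF extreme_point_inv_at_one[OF ext 2]] z by auto
      then show ?thesis
        using False by (simp add: lookup_minus lookup_single)
    qed
  qed
qed

end
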